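(* The boundary of any Marchwicki--Miska Cantorval is of Lebesgue measure zero. That is, for every sequence $(n_k)_{k\in\mathbb N}$ of positive integers, if $(a_i)_{i\in\mathbb N}$ is the Marchwicki--Miska sequence associated with $(n_k)$, then the topological boundary in $\mathbb R$ of the achievement set $E(a_i)$ has Lebesgue measure zero.
   Context: $\mathbb N=\{1,2,3,\ldots\}$. For a sequence $(a_i)_{i\in\mathbb N}$ of non-negative real numbers with $\sum a_i$ convergent, its achievement set (set of subsums) is $$E(a_i):=\Bigl\{x\in\mathbb R:\ \exists A\subset\mathbb N\ \ x=\sum_{i\in A}a_i\Bigr\}$$ (the empty sum is $0$). For a positive integer $n$ define $$b_1^n:=2^{n+1},\qquad b_2^n:=2^n+1,\qquad b_j^n:=2^{n+3-j}\ \text{ for } 3\le j\le n+2.$$ Given a sequence $(n_k)_{k\in\mathbb N}$ of positive integers, put $q_1:=1$ and $q_{k+1}:=\dfrac{q_k}{3\cdot 2^{n_{k+1}}}$ for $k\in\mathbb N$, i.e. $q_k=3^{1-k}\prod_{j=2}^{k}2^{-n_j}$ (an empty product equals $1$). Put $N_0:=0$ and $N_k:=\sum_{j=1}^k(n_j+2)$. The Marchwicki--Miska sequence associated with $(n_k)$ is the sequence $(a_i)_{i\in\mathbb N}$ defined by $$a_i:=b^{n_k}_{\,i-N_{k-1}}\,q_k\qquad\text{for } k\in\mathbb N \text{ and } N_{k-1}<i\le N_k.$$ It is a decreasing sequence of positive numbers with convergent sum. Its achievement set $E(a_i)$ is called a Marchwicki--Miska Cantorval (it is a Cantorval: a bounded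 subset of $\mathbb R$ equal to the closure of its interior, whose boundary is homeomorphic to the ternary Cantor set). *)

theory Defs
  imports "HOL-Analysis.Analysis"
begin

text \<open>All sequences are indexed by the positive integers; their values at \<open>0\<close> are irrelevant.\<close>

definition achievement_set :: "(nat \<Rightarrow> real) \<Rightarrow> real set" where
  "achievement_set a = {x. \<exists>A \<subseteq> {1..}. (a has_sum x) A}"

text \<open>Only the arguments \<open>1 \<le> j \<le> n + 2\<close> are meaningful; there the subtraction in the exponent
  does not truncate.\<close>

definition mm_b :: "nat \<Rightarrow> nat \<Rightarrow> real" where
  "mm_b n j = (if j = 1 then 2 ^ (n + 1) else if j = 2 then 2 ^ n + 1 else 2 ^ (n + 3 - j))"

fun mm_q :: "(nat \<Rightarrow> nat) \<Rightarrow> nat \<Rightarrow> real" where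
  "mm_q n 0 = 1"
| "mm_q n (Suc 0) = 1"
| "mm_q n (Suc (Suc k)) = mm_q n (Suc k) / (3 * 2 ^ n (Suc (Suc k)))"

definition mm_N :: "(nat \<Rightarrow> nat) \<Rightarrow> nat \<Rightarrow> nat" where
  "mm_N n k = (\<Sum>j = 1..k. (n j + 2))"

definition mm_block :: "(nat \<Rightarrow> nat) \<Rightarrow> nat \<Rightarrow> nat" where
  "mm_block n i = (THE k. 1 \<le> k \<and> mm_N n (k - 1) < i \<and> i \<le> mm_N n k)"

definition mm_seq :: "(nat \<Rightarrow> nat) \<Rightarrow> nat \<Rightarrow> real" where
  "mm_seq n i = (let k = mm_block n i in mm_b (n k) (i - mm_N n (k - 1)) * mm_q n k)"

definition mm_cantorval :: "(nat \<Rightarrow> nat) \<Rightarrow> real set" where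
  "mm_cantorval n = achievement_set (mm_seq n)"

text \<open>The blocks partition the positive integers, so the description in \<^const>\<open>mm_block\<close> is proper.\<close>

lemma mm_N_0 [simp]: "mm_N n 0 = 0"
  by (simp add: mm_N_def)

lemma mm_N_Suc: "mm_N n (Suc k) = mm_N n k + (n (Suc k) + 2)"
  by (simp add: mm_N_def)

lemma mm_N_mono: "k \<le> l \<Longrightarrow> mm_N n k \<le> mm_N n l"
  by (rule lift_Suc_mono_le) (simp_all add: mm_N_Suc)

lemma mm_N_ge: "k \<le> mm_N n k"
  by (induction k) (simp_all add: mm_N_Suc)

lemma mm_block_unique:
  assumes "1 \<le> k" "mm_N n (k - 1) < i" "i \<le> mm_N n k"
    and "1 \<le> l" "mm_N n (l - 1) < i" "i \<le> mm_N n l"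
  shows "k = l"
proof (rule ccontr)
  assume "k \<noteq> l"
  then consider "k \<le> l - 1" | "l \<le> k - 1" by linarith
  then show False
    using mm_N_mono[of k "l - 1" n] mm_N_mono[of l "k - 1" n] assms by cases auto
qed

lemma mm_block_exists:
  assumes "1 \<le> i"
  shows "\<exists>k\<ge>1. mm_N n (k - 1) < i \<and> i \<le> mm_N n k"
proof -
  define k where "k = (LEAST k. i \<le> mm_N n k)"
  have le: "i \<le> mm_N n k"
    unfolding k_def by (rule LeastI[of _ i]) (rule mm_N_ge)
  with assms have "k \<noteq> 0" by (metis mm_N_0 not_one_le_zero order_trans)
  then have "\<not> i \<le> mm_N n (k - 1)"
    unfolding k_def by (intro not_less_Least) simp
  with le \<open>k \<noteq> 0\<close> show ?thesis by (intro exI[of _ k]) auto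
qed

lemma mm_seq_eq:
  assumes "1 \<le> k" "mm_N n (k - 1) < i" "i \<le> mm_N n k"
  shows "mm_seq n i = mm_b (n k) (i - mm_N n (k - 1)) * mm_q n k"
proof -
  have "mm_block n i = k"
    unfolding mm_block_def using assms mm_block_unique by (intro the_equality) blast+
  then show ?thesis by (simp add: mm_seq_def)
qed

end

(* Write q for the scale of block k. The sums of the first k blocks are integer multiples g * q, and
   the subsums of the later blocks contain an interval of length exactly q, so each g provides an interval
   g * q + [r, r + q] inside E. These intervals, taken over all integers, tile the line, and
   everything else in E lies in tiles whose index is not a prefix sum but is adjacent to one; only
   such tiles meet the frontier. Passing to the next level splits every tile into 3 * 2^m tiles, of
   which at most 2^m + 2 are again of this kind, so the measure of their union shrinks by a factor
   of at most 2/3. *)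

theory Submission
  imports Defs "HOL-Library.Nat_Bijection"
begin

section \<open>Subset sums of a single block\<close>

text \<open>For positive \<open>m\<close> these are the unscaled subsums of one block: without the
  second term \<open>2 ^ m + 1\<close> the sums are the even numbers below \<open>4 * 2 ^ m\<close>,
  and adding that term shifts them to the odd numbers.\<close>

definition digits :: "nat \<Rightarrow> int set" where
  "digits m = {d. 0 \<le> d \<and> d < 4 * 2 ^ m \<and> even d} \<union> {d. 2 ^ m \<le> d \<and> d < 5 * 2 ^ m \<and> odd d}"

lemma set_encode_less: "S \<subseteq> {..m} \<Longrightarrow> set_encode S < 2 ^ Suc m"
proof -
  assume "S \<subseteq> {..m}"
  then have "set_encode S \<le> (\<Sum>i\<le>m. 2 ^ i)"
    unfolding set_encode_def by (intro sum_mono2) auto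
  also have "\<dots> < 2 ^ Suc m"
    by (induction m) auto
  finally show ?thesis .
qed

lemma set_decode_subset:
  assumes "x < 2 ^ Suc m"
  shows "set_decode x \<subseteq> {..m}"
proof
  fix i assume i: "i \<in> set_decode x"
  show "i \<in> {..m}"
  proof (rule ccontr)
    assume "i \<notin> {..m}"
    then have "(2::nat) ^ Suc m \<le> 2 ^ i"
      by (intro power_increasing) auto
    with assms have "x div 2 ^ i = 0"
      by simp
    with i show False
      by (simp add: set_decode_def)
  qed
qed

text \<open>Apart from the second term, a block consists of \<open>2 * 2 ^ i\<close> for
  \<open>i \<le> m\<close>, so its subset sums are binary expansions. The map \<open>h\<close> finds
  the position of each power; the largest sits at position 1, since position 2 holds the exceptional
  term.\<close>

lemma mm_b_evens_bij:
  fixes m :: nat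
  assumes "m \<ge> 1"
  defines "h \<equiv> \<lambda>i. if i = m then 1 else m + 2 - i"
  shows "bij_betw h {..m} ({1..m+2} - {2})"
    and "\<And>i. i \<le> m \<Longrightarrow> mm_b m (h i) = 2 * 2 ^ i"
proof -
  show "bij_betw h {..m} ({1..m+2} - {2})"
    by (rule bij_betw_byWitness[where f' = "\<lambda>j. if j = 1 then m else m + 2 - j"])
       (use assms(1) in \<open>auto simp: h_def\<close>)
next
  fix i assume "i \<le> m"
  then show "mm_b m (h i) = 2 * 2 ^ i"
    using assms(1) by (auto simp: h_def mm_b_def Suc_diff_le numeral_2_eq_2 simp flip: power_Suc)
qed

lemma sum_mm_b_evens:
  assumes "m \<ge> 1" "S \<subseteq> {..m}"
  defines "h \<equiv> \<lambda>i. if i = m then 1 else m + 2 - i"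
  shows "sum (mm_b m) (h ` S) = real (2 * set_encode S)"
proof -
  have "inj_on h S"
    using mm_b_evens_bij(1)[OF assms(1)] assms(2) unfolding h_def bij_betw_def
    by (meson inj_on_subset)
  then have "sum (mm_b m) (h ` S) = (\<Sum>i\<in>S. mm_b m (h i))"
    by (simp add: sum.reindex)
  also have "\<dots> = (\<Sum>i\<in>S. 2 * 2 ^ i)"
    using assms(2) unfolding h_def by (intro sum.cong refl mm_b_evens_bij(2)[OF assms(1)]) auto
  also have "\<dots> = real (2 * set_encode S)"
    by (simp add: set_encode_def sum_distrib_left)
  finally show ?thesis .
qed

lemma sum_mm_b_in_digits:
  assumes "m \<ge> 1" "J \<subseteq> {1..m+2}"
  shows "\<exists>d\<in>digits m. sum (mm_b m) J = of_int d"
proof -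
  define h where "h = (\<lambda>i. if i = m then 1 else m + 2 - i)"
  have "J - {2} \<subseteq> h ` {..m}"
    using mm_b_evens_bij(1)[OF assms(1)] assms(2) by (auto simp: bij_betw_def h_def)
  then obtain S where S: "S \<subseteq> {..m}" "J - {2} = h ` S"
    by (meson subset_image_iff)
  define e where "e = set_encode S"
  have e: "e < 2 * 2 ^ m"
    using set_encode_less[OF S(1)] by (simp add: e_def)
  then have e': "int e < 2 * 2 ^ m"
    by (metis (mono_tags) of_nat_less_iff of_nat_mult of_nat_numeral of_nat_power)
  have sum_e: "sum (mm_b m) (J - {2}) = real (2 * e)"
    unfolding S(2) e_def h_def by (rule sum_mm_b_evens[OF assms(1) S(1)])
  have fin: "finite J"
    using assms(2) finite_subset by blast
  show ?thesis
  proof (cases "2 \<in> J")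
    case True
    then have "sum (mm_b m) J = real (2 * e) + 2 ^ m + 1"
      using sum.remove[OF fin True, of "mm_b m"] sum_e by (simp add: mm_b_def)
    moreover have "2 * int e + 2 ^ m + 1 \<in> digits m"
      using e' assms(1) by (auto simp: digits_def)
    ultimately show ?thesis
      by (intro bexI[of _ "2 * int e + 2 ^ m + 1"]) auto
  next
    case False
    with sum_e have "sum (mm_b m) J = real (2 * e)"
      by simp
    moreover have "2 * int e \<in> digits m"
      using e' by (auto simp: digits_def)
    ultimately show ?thesis
      by (intro bexI[of _ "2 * int e"]) auto
  qed
qed

lemma digits_eq_sum_mm_b:
  assumes "m \<ge> 1" "d \<in> digits m"
  shows "\<exists>J \<subseteq> {1..m+2}. sum (mm_b m) J = of_int d"
proof -
  define h where "h = (\<lambda>i. if i = m then 1 else m + 2 - i)"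
  have ev: "\<exists>J \<subseteq> {1..m+2} - {2}. sum (mm_b m) J = of_int (2 * e)" if "0 \<le> e" "e < 2 * 2 ^ m" for e
  proof -
    have "nat e < 2 ^ Suc m"
      using that by (simp add: nat_less_iff)
    then have S: "set_decode (nat e) \<subseteq> {..m}"
      by (rule set_decode_subset)
    have "h ` set_decode (nat e) \<subseteq> {1..m+2} - {2}"
      using mm_b_evens_bij(1)[OF assms(1)] S unfolding bij_betw_def h_def by blast
    moreover have "sum (mm_b m) (h ` set_decode (nat e)) = of_int (2 * e)"
      using sum_mm_b_evens[OF assms(1) S] that by (simp add: h_def)
    ultimately show ?thesis
      by blast
  qed
  show ?thesis
  proof (cases "even d")
    case True
    then obtain e where "d = 2 * e" by blast
    with assms(2) have "0 \<le> e" "e < 2 * 2 ^ m"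
      by (auto simp: digits_def)
    then obtain J where "J \<subseteq> {1..m+2} - {2}" "sum (mm_b m) J = of_int (2 * e)"
      using ev[of e] by auto
    with \<open>d = 2 * e\<close> show ?thesis
      by (intro exI[of _ J]) auto
  next
    case False
    \<comment> \<open>Positivity of \<open>m\<close> makes the exceptional term
      \<open>2 ^ m + 1\<close> odd, so subtracting it from an odd digit leaves an even sum of the
      other terms.\<close>
    have "even ((2::int) ^ m)"
      using assms(1) by simp
    with False have "even (d - 2 ^ m - 1)" and ne: "2 ^ m \<noteq> d"
      by auto
    then obtain e where e: "d - 2 ^ m - 1 = 2 * e" by blast
    have "2 ^ m \<le> d" "d < 5 * 2 ^ m"
      using assms(2) False by (auto simp: digits_def)
    with e ne have "0 \<le> e" "e < 2 * 2 ^ m"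
      by linarith+
    then obtain J where J: "J \<subseteq> {1..m+2} - {2}" "sum (mm_b m) J = of_int (2 * e)"
      using ev[of e] by auto
    from J(1) have "2 \<notin> J" "finite J"
      using finite_subset[OF J(1)] by auto
    then have "sum (mm_b m) (insert 2 J) = of_int (2 * e + 2 ^ m + 1)"
      using J by (simp add: mm_b_def)
    also have "2 * e + 2 ^ m + 1 = d"
      using e by simp
    finally show ?thesis
      using J(1) by (intro exI[of _ "insert 2 J"]) auto
  qed
qed

section \<open>Offsets of gaps inside a tile\<close>

text \<open>The offsets next to the sparse digits that reach into a tile from its neighbours: the
  odd digits above \<open>4 * 2 ^ m\<close> of the left neighbour and the even digits below
  \<open>2 ^ m\<close> of the right one.\<close>

definition gap_digits :: "nat \<Rightarrow> int set" where
  "gap_digits m = {j. even j \<and> 0 \<le> j \<and> j \<le> 2 ^ m} \<union>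
    {j. odd j \<and> 2 * 2 ^ m - 1 \<le> j \<and> j < 3 * 2 ^ m}"

lemma
  shows finite_gap_digits: "finite (gap_digits m)"
    and card_gap_digits: "m \<ge> 1 \<Longrightarrow> card (gap_digits m) \<le> 2 ^ m + 2"
proof -
  show "finite (gap_digits m)"
  proof (rule finite_subset)
    define p :: int where "p = 2 ^ m"
    have "0 < p"
      by (simp add: p_def)
    then show "gap_digits m \<subseteq> {0..3 * 2 ^ m}"
      unfolding gap_digits_def p_def[symmetric] by auto
  qed simp
  assume "m \<ge> 1"
  then obtain l where l: "m = Suc l"
    by (cases m) auto
  \<comment> \<open>Halving the even offsets, and the odd ones after adding 1, leaves two integer
    ranges of \<open>2 ^ l + 1\<close> elements each.\<close>
  have "gap_digits m \<subseteq> (\<lambda>i. 2 * i) ` {0..2 ^ l} \<union> (\<lambda>i. 2 * i - 1) ` {2 * 2 ^ l..3 * 2 ^ l}"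
  proof
    fix j assume j: "j \<in> gap_digits m"
    show "j \<in> (\<lambda>i. 2 * i) ` {0..2 ^ l} \<union> (\<lambda>i. 2 * i - 1) ` {2 * 2 ^ l..3 * 2 ^ l}"
    proof (cases "even j")
      case True
      then obtain i where "j = 2 * i" by blast
      with j show ?thesis
        by (intro UnI1 image_eqI[of _ _ i]) (auto simp: gap_digits_def l)
    next
      case False
      then obtain i where "j = 2 * i + 1" by (rule oddE)
      with j show ?thesis
        by (intro UnI2 image_eqI[of _ _ "i + 1"]) (auto simp: gap_digits_def l)
    qed
  qed
  then have "card (gap_digits m) \<le>
      card ((\<lambda>i::int. 2 * i) ` {0..2 ^ l} \<union> (\<lambda>i. 2 * i - 1) ` {2 * 2 ^ l..3 * 2 ^ l})"
    by (intro card_mono) auto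
  also have "\<dots> \<le> card {0..(2::int) ^ l} + card {2 * 2 ^ l..3 * (2::int) ^ l}"
    by (intro order_trans[OF card_Un_le] add_mono card_image_le) auto
  also have "\<dots> = 2 ^ m + 2"
    by (simp add: l nat_add_distrib nat_power_eq)
  finally show "card (gap_digits m) \<le> 2 ^ m + 2" .
qed

section \<open>Scales and block sums of the sequence\<close>

locale mm_sequence =
  fixes n :: "nat \<Rightarrow> nat"
  assumes n_pos: "\<And>k. k \<ge> 1 \<Longrightarrow> n k \<ge> 1"
begin

text \<open>Starting the recursion at level \<open>0\<close>, with the single prefix sum \<open>0\<close>, requires this value
  of the scale there.\<close>

definition scale :: "nat \<Rightarrow> real" where
  "scale k = (if k = 0 then 3 * 2 ^ n 1 else mm_q n k)"

lemma scale_eq_Suc: "scale k = 3 * 2 ^ n (Suc k) * scale (Suc k)"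
  by (cases k) (simp_all add: scale_def)

lemma scale_pos: "0 < scale k"
  by (induction k) (use scale_eq_Suc in \<open>auto simp: scale_def zero_less_mult_iff\<close>)

lemma two_le_power_n: "2 \<le> (2::'a::linordered_idom) ^ n (Suc k)"
  using power_increasing[of 1 "n (Suc k)" "2::'a"] n_pos[of "Suc k"] by simp

lemma sum_block:
  assumes "J \<subseteq> {1..n (Suc k) + 2}"
  shows "sum (mm_seq n) ((+) (mm_N n k) ` J) = sum (mm_b (n (Suc k))) J * scale (Suc k)"
proof -
  have "sum (mm_seq n) ((+) (mm_N n k) ` J) = (\<Sum>j\<in>J. mm_seq n (mm_N n k + j))"
    by (simp add: sum.reindex)
  also have "\<dots> = (\<Sum>j\<in>J. mm_b (n (Suc k)) j * scale (Suc k))"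
  proof (rule sum.cong)
    fix j assume "j \<in> J"
    then have "1 \<le> j" "j \<le> n (Suc k) + 2"
      using assms by auto
    then show "mm_seq n (mm_N n k + j) = mm_b (n (Suc k)) j * scale (Suc k)"
      using mm_seq_eq[of "Suc k" n "mm_N n k + j"] by (simp add: mm_N_Suc scale_def)
  qed simp
  finally show ?thesis
    by (simp add: sum_distrib_right)
qed

lemma mm_seq_nonneg: "1 \<le> i \<Longrightarrow> 0 \<le> mm_seq n i"
proof -
  assume "1 \<le> i"
  then obtain k where k: "k \<ge> 1" "mm_N n (k - 1) < i" "i \<le> mm_N n k"
    using mm_block_exists by blast
  then show ?thesis
    using mm_seq_eq[OF k] scale_pos[of k] by (simp add: mm_b_def scale_def)
qed

lemma block_sum_in_digits:
  assumes "F \<subseteq> {mm_N n k<..mm_N n (Suc k)}"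
  shows "\<exists>d\<in>digits (n (Suc k)). sum (mm_seq n) F = of_int d * scale (Suc k)"
proof -
  define J where "J = (\<lambda>i. i - mm_N n k) ` F"
  have "J \<subseteq> {1..n (Suc k) + 2}"
    using assms by (fastforce simp: J_def mm_N_Suc)
  moreover have "(+) (mm_N n k) ` J = F"
  proof -
    have "(+) (mm_N n k) ` J = (\<lambda>i. i) ` F"
      unfolding J_def image_image using assms by (intro image_cong) auto
    then show ?thesis
      by simp
  qed
  ultimately show ?thesis
    using sum_block[of J k] sum_mm_b_in_digits[OF n_pos, of "Suc k" J] by auto
qed

lemma digits_eq_block_sum:
  assumes "d \<in> digits (n (Suc k))"
  shows "\<exists>F \<subseteq> {mm_N n k<..mm_N n (Suc k)}. sum (mm_seq n) F = of_int d * scale (Suc k)"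
proof -
  obtain J where J: "J \<subseteq> {1..n (Suc k) + 2}" "sum (mm_b (n (Suc k))) J = of_int d"
    using digits_eq_sum_mm_b[OF n_pos assms] by auto
  have "(+) (mm_N n k) ` J \<subseteq> {mm_N n k<..mm_N n (Suc k)}"
    using J(1) by (force simp: mm_N_Suc)
  then show ?thesis
    using sum_block[OF J(1)] J(2) by metis
qed

section \<open>Sums over the first blocks\<close>

text \<open>These are the sums over subsets of the first \<open>k\<close> blocks in units of
  \<open>scale k\<close>; the factor in the recursion converts this unit to that of the next
  level.\<close>

primrec prefix_sums :: "nat \<Rightarrow> int set" where
  "prefix_sums 0 = {0}"
| "prefix_sums (Suc k) =
    {3 * 2 ^ n (Suc k) * g + d | g d. g \<in> prefix_sums k \<and> d \<in> digits (n (Suc k))}"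

lemma atLeastAtMost_mm_N_Suc:
  "{1..mm_N n (Suc k)} = {1..mm_N n k} \<union> {mm_N n k<..mm_N n (Suc k)}"
  using mm_N_mono[of k "Suc k" n] by auto

lemma sum_in_prefix_sums:
  "F \<subseteq> {1..mm_N n k} \<Longrightarrow> \<exists>g\<in>prefix_sums k. sum (mm_seq n) F = of_int g * scale k"
proof (induction k arbitrary: F)
  case 0
  then show ?case by simp
next
  case (Suc k)
  let ?F1 = "F \<inter> {1..mm_N n k}" and ?F2 = "F \<inter> {mm_N n k<..mm_N n (Suc k)}"
  obtain g where g: "g \<in> prefix_sums k" "sum (mm_seq n) ?F1 = of_int g * scale k"
    using Suc.IH[of ?F1] by auto
  obtain d where d: "d \<in> digits (n (Suc k))" "sum (mm_seq n) ?F2 = of_int d * scale (Suc k)"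
    using block_sum_in_digits[of ?F2 k] by auto
  have "F = ?F1 \<union> ?F2"
    using Suc.prems atLeastAtMost_mm_N_Suc[of k] by blast
  then have "sum (mm_seq n) F = sum (mm_seq n) (?F1 \<union> ?F2)"
    by simp
  also have "\<dots> = sum (mm_seq n) ?F1 + sum (mm_seq n) ?F2"
    by (rule sum.union_disjoint) auto
  also have "\<dots> = of_int (3 * 2 ^ n (Suc k) * g + d) * scale (Suc k)"
    unfolding g d scale_eq_Suc[of k] by (simp add: algebra_simps)
  finally show ?case
    by (rule bexI) (use g(1) d(1) in auto)
qed

lemma prefix_sums_eq_sum:
  "g \<in> prefix_sums k \<Longrightarrow> \<exists>F \<subseteq> {1..mm_N n k}. sum (mm_seq n) F = of_int g * scale k"
proof (induction k arbitrary: g)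
  case 0
  then show ?case by auto
next
  case (Suc k)
  then obtain g' d where gd: "g = 3 * 2 ^ n (Suc k) * g' + d" "g' \<in> prefix_sums k"
    "d \<in> digits (n (Suc k))" by auto
  obtain F1 where F1: "F1 \<subseteq> {1..mm_N n k}" "sum (mm_seq n) F1 = of_int g' * scale k"
    using Suc.IH gd(2) by blast
  obtain F2 where F2: "F2 \<subseteq> {mm_N n k<..mm_N n (Suc k)}"
    "sum (mm_seq n) F2 = of_int d * scale (Suc k)"
    using digits_eq_block_sum[OF gd(3)] by blast
  have "finite F1" "finite F2" "F1 \<inter> F2 = {}"
    using F1 F2 finite_subset[OF F1(1)] finite_subset[OF F2(1)] by force+
  then have "sum (mm_seq n) (F1 \<union> F2) = sum (mm_seq n) F1 + sum (mm_seq n) F2"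
    by (rule sum.union_disjoint)
  also have "\<dots> = of_int g * scale (Suc k)"
    unfolding F1(2) F2(2) gd(1) scale_eq_Suc[of k] by (simp add: algebra_simps)
  finally show ?case
    using F1(1) F2(1) atLeastAtMost_mm_N_Suc[of k] by (intro exI[of _ "F1 \<union> F2"]) auto
qed

section \<open>Decay of the scales and size of the tails\<close>

lemma scale_Suc_le: "scale (Suc k) \<le> scale k / 6"
proof -
  have "6 * scale (Suc k) \<le> 3 * 2 ^ n (Suc k) * scale (Suc k)"
    using two_le_power_n[of k, where 'a = real] scale_pos[of "Suc k"]
    by (intro mult_right_mono) auto
  then show ?thesis
    using scale_eq_Suc[of k] by simp
qed

lemma scale_add_le: "scale (k + i) \<le> scale k * (1 / 6) ^ i"
proof (induction i)
  case (Suc i)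
  with scale_Suc_le[of "k + i"] show ?case by simp
qed simp

lemma summable_scale: "summable (\<lambda>i. scale (k + i))"
proof (rule summable_comparison_test')
  show "summable (\<lambda>i. scale k * (1 / 6) ^ i)"
    by (intro summable_mult summable_geometric) simp
  show "norm (scale (k + i)) \<le> scale k * (1 / 6) ^ i" for i
    using scale_add_le[of k i] scale_pos[of "k + i"] by simp
qed

lemma scale_tendsto_0: "scale \<longlonglongrightarrow> 0"
  using summable_LIMSEQ_zero[OF summable_scale[of 0]] by simp

text \<open>Equals \<open>\<Sum>j>k. 2 ^ n j * scale j\<close>: the least sum of the blocks after \<open>k\<close> in which every digit
  lies in the gap-free range \<open>{2 ^ m..<4 * 2 ^ m}\<close> of \<open>digits m\<close>.\<close>

definition tail :: "nat \<Rightarrow> real" where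
  "tail k = (\<Sum>i. scale (k + i)) / 3"

lemma tail_eq: "tail k = scale k / 3 + tail (Suc k)"
  using suminf_split_head[OF summable_scale[of k]] by (simp add: tail_def field_simps)

lemma tail_eq_Suc: "tail k = 2 ^ n (Suc k) * scale (Suc k) + tail (Suc k)"
  using tail_eq[of k] scale_eq_Suc[of k] by simp

lemma tail_nonneg: "0 \<le> tail k"
  unfolding tail_def using suminf_nonneg[OF summable_scale[of k]] less_imp_le[OF scale_pos] by simp

text \<open>The scales decay at least geometrically with ratio 1/6, which gives
  \<open>tail k \<le> 2/5 * scale k\<close>. Hence the part of E outside the full tiles reaches only
  into the tiles next to them.\<close>

lemma tail_less_scale: "tail k < scale k"
proof -
  have "(\<Sum>i. scale (k + i)) \<le> (\<Sum>i. scale k * (1 / 6) ^ i)"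
    by (intro suminf_le scale_add_le summable_scale summable_mult summable_geometric) simp
  also have "\<dots> = scale k * (6 / 5)"
    by (subst suminf_mult) (simp_all add: suminf_geometric summable_geometric)
  also have "\<dots> < scale k * 3"
    using scale_pos[of k] by simp
  finally show ?thesis
    by (simp add: tail_def)
qed

section \<open>Intervals inside the Cantorval\<close>

lemma middle_digits: "2 ^ m \<le> d \<Longrightarrow> d < 4 * 2 ^ m \<Longrightarrow> d \<in> digits m"
  using zero_less_power[of "2::int" m] by (auto simp: digits_def simp del: zero_less_power)

text \<open>The gap-free digits \<open>2 ^ m + j\<close> with \<open>0 \<le> j < 3 * 2 ^ m\<close>
  translate the interval of the next level so that the copies abut and exactly cover the interval of
  level \<open>k\<close>.\<close>

lemma ex_digit:
  assumes "tail k \<le> y" "y \<le> tail k + scale k"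
  shows "\<exists>d\<in>digits (n (Suc k)).
    tail (Suc k) \<le> y - of_int d * scale (Suc k) \<and>
    y - of_int d * scale (Suc k) \<le> tail (Suc k) + scale (Suc k)"
proof -
  define z where "z = (y - tail k) / scale (Suc k)"
  \<comment> \<open>The minimum matters only at the right endpoint, where the floor is
    \<open>3 * 2 ^ n (Suc k)\<close>, one more than the last admissible offset.\<close>
  define j where "j = min \<lfloor>z\<rfloor> (3 * 2 ^ n (Suc k) - 1)"
  have pos: "0 < scale (Suc k)"
    by (rule scale_pos)
  have y: "y = tail k + z * scale (Suc k)"
    using pos by (simp add: z_def)
  have z: "0 \<le> z" "z \<le> 3 * 2 ^ n (Suc k)"
    using assms pos scale_eq_Suc[of k] by (auto simp: z_def field_simps)
  have "(1::int) \<le> 2 ^ n (Suc k)"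
    by simp
  then have j: "0 \<le> j" "j < 3 * 2 ^ n (Suc k)"
    using z by (auto simp: j_def)
  have "of_int j \<le> z"
    by (simp add: j_def) linarith
  moreover have "z \<le> of_int j + 1"
  proof (cases "\<lfloor>z\<rfloor> \<le> 3 * 2 ^ n (Suc k) - 1")
    case True
    then show ?thesis
      unfolding j_def by linarith
  next
    case False
    then have "j = 3 * 2 ^ n (Suc k) - 1"
      by (simp add: j_def)
    then have "real_of_int j = 3 * 2 ^ n (Suc k) - 1"
      by simp
    with z show ?thesis
      by simp
  qed
  ultimately have "of_int j * scale (Suc k) \<le> z * scale (Suc k)"
    "z * scale (Suc k) \<le> (of_int j + 1) * scale (Suc k)"
    using pos by (auto intro: mult_right_mono)
  then show ?thesis
    using j y tail_eq_Suc[of k]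
    by (intro bexI[of _ "2 ^ n (Suc k) + j"] middle_digits) (auto simp: algebra_simps)
qed

text \<open>Digits are chosen block by block so that the remainder stays in the interval of the
  current level. These intervals shrink to 0, so the union of the chosen index sets has sum
  \<open>x\<close>.\<close>

lemma interval_subset_cantorval:
  assumes F: "F \<subseteq> {1..mm_N n k}"
    and x: "tail k \<le> x - sum (mm_seq n) F" "x - sum (mm_seq n) F \<le> tail k + scale k"
  shows "x \<in> mm_cantorval n"
proof -
  define P where "P = (\<lambda>i G. G \<subseteq> {1..mm_N n (k + i)} \<and> tail (k + i) \<le> x - sum (mm_seq n) G \<and>
    x - sum (mm_seq n) G \<le> tail (k + i) + scale (k + i))"
  have "\<exists>G. \<forall>i. P i (G i) \<and> G i \<subseteq> G (Suc i)"
  proof (rule dependent_nat_choice)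
    show "\<exists>G. P 0 G"
      using assms by (auto simp: P_def)
    fix G i assume G: "P i G"
    obtain d where d: "d \<in> digits (n (Suc (k + i)))"
      "tail (Suc (k + i)) \<le> x - sum (mm_seq n) G - of_int d * scale (Suc (k + i))"
      "x - sum (mm_seq n) G - of_int d * scale (Suc (k + i))
         \<le> tail (Suc (k + i)) + scale (Suc (k + i))"
      using ex_digit[of "k + i" "x - sum (mm_seq n) G"] G by (auto simp: P_def)
    obtain H where H: "H \<subseteq> {mm_N n (k + i)<..mm_N n (Suc (k + i))}"
      "sum (mm_seq n) H = of_int d * scale (Suc (k + i))"
      using digits_eq_block_sum[OF d(1)] by blast
    have G': "G \<subseteq> {1..mm_N n (k + i)}"
      using G by (simp add: P_def)
    have "finite G" "finite H" "G \<inter> H = {}"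
      using finite_subset[OF G'] finite_subset[OF H(1)] G' H(1) by force+
    then have "sum (mm_seq n) (G \<union> H) = sum (mm_seq n) G + of_int d * scale (Suc (k + i))"
      using H(2) by (simp add: sum.union_disjoint)
    moreover have "G \<union> H \<subseteq> {1..mm_N n (Suc (k + i))}"
      using G' H(1) atLeastAtMost_mm_N_Suc[of "k + i"] by auto
    ultimately have "P (Suc i) (G \<union> H)"
      using d by (auto simp: P_def algebra_simps)
    then show "\<exists>G'. P (Suc i) G' \<and> G \<subseteq> G'"
      by blast
  qed
  then obtain G where G: "\<And>i. P i (G i)" "\<And>i. G i \<subseteq> G (Suc i)"
    by blast
  have fin: "finite (G i)" for i
    using G(1)[of i] finite_subset by (auto simp: P_def)
  have mono: "incseq G"
    using G(2) by (rule incseq_SucI)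
  define A where "A = (\<Union>i. G i)"
  have A: "A \<subseteq> {1..}"
    using G(1) by (fastforce simp: A_def P_def)
  have le: "sum (mm_seq n) X \<le> x" if X: "finite X" "X \<subseteq> A" for X
  proof -
    have "\<exists>i. X \<subseteq> G i"
      using X
    proof (induction X)
      case (insert a X)
      then obtain i j where "X \<subseteq> G i" "a \<in> G j"
        by (auto simp: A_def)
      moreover have "G i \<subseteq> G (max i j)" "G j \<subseteq> G (max i j)"
        using mono by (auto simp: incseq_def)
      ultimately show ?case by blast
    qed simp
    then obtain i where "X \<subseteq> G i" by blast
    then have "sum (mm_seq n) X \<le> sum (mm_seq n) (G i)"
      using fin[of i] A by (intro sum_mono2 mm_seq_nonneg) (auto simp: A_def)
    with G(1)[of i] tail_nonneg[of "k + i"] show ?thesis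
      by (auto simp: P_def)
  qed
  \<comment> \<open>The terms are nonnegative, so convergence follows from the upper bound
    \<open>x\<close> and from finite sets \<open>G i\<close> whose sums come arbitrarily close to
    \<open>x\<close>.\<close>
  have "(sum (mm_seq n) \<longlongrightarrow> x) (finite_subsets_at_top A)"
  proof (rule increasing_tendsto)
    show "\<forall>\<^sub>F X in finite_subsets_at_top A. sum (mm_seq n) X \<le> x"
      using le by (rule eventually_finite_subsets_at_top_weakI)
    fix y assume "y < x"
    \<comment> \<open>The remainder is at most \<open>tail + scale\<close>, hence below twice the
      scale; this is where the 2 comes from.\<close>
    then have "\<forall>\<^sub>F i in sequentially. scale i < (x - y) / 2"
      using scale_tendsto_0 by (intro order_tendstoD) auto
    then obtain i where i: "scale (k + i) < (x - y) / 2"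
      by (meson eventually_sequentially le_add2)
    then have "y < sum (mm_seq n) (G i)"
      using G(1)[of i] tail_less_scale[of "k + i"]
      unfolding P_def by (simp add: field_simps)
    moreover have "sum (mm_seq n) (G i) \<le> sum (mm_seq n) X" if "finite X" "G i \<subseteq> X" "X \<subseteq> A" for X
      using that A by (intro sum_mono2 mm_seq_nonneg) auto
    ultimately show "\<forall>\<^sub>F X in finite_subsets_at_top A. y < sum (mm_seq n) X"
      unfolding eventually_finite_subsets_at_top using fin[of i]
      by (intro exI[of _ "G i"]) (auto simp: A_def less_le_trans)
  qed
  then show ?thesis
    using A by (auto simp: mm_cantorval_def achievement_set_def has_sum_def)
qed

lemma prefix_interval_subset_cantorval:
  assumes "g \<in> prefix_sums k"
  shows "{of_int g * scale k + tail k..of_int g * scale k + tail k + scale k} \<subseteq> mm_cantorval n"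
proof
  fix x assume x: "x \<in> {of_int g * scale k + tail k..of_int g * scale k + tail k + scale k}"
  obtain F where "F \<subseteq> {1..mm_N n k}" "sum (mm_seq n) F = of_int g * scale k"
    using prefix_sums_eq_sum[OF assms] by blast
  with x show "x \<in> mm_cantorval n"
    by (intro interval_subset_cantorval) auto
qed

section \<open>Upper bounds for the remaining blocks\<close>

text \<open>The largest digit is \<open>5 * 2 ^ m - 1\<close>. The bound has the form of a
  difference so that it telescopes over consecutive blocks.\<close>

lemma sum_block_le:
  assumes "F \<subseteq> {mm_N n k<..mm_N n (Suc k)}"
  shows "sum (mm_seq n) F \<le> (scale k + 2 * tail k) - (scale (Suc k) + 2 * tail (Suc k))"
proof -
  obtain d where d: "d \<in> digits (n (Suc k))" "sum (mm_seq n) F = of_int d * scale (Suc k)"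
    using block_sum_in_digits[OF assms] by blast
  have "0 < (2::int) ^ n (Suc k)"
    by simp
  with d(1) have "d \<le> 5 * 2 ^ n (Suc k) - 1"
    unfolding digits_def by auto
  then have "real_of_int d \<le> of_int (5 * 2 ^ n (Suc k) - 1)"
    by (rule of_int_le_iff[THEN iffD2])
  then have "real_of_int d * scale (Suc k) \<le> (5 * 2 ^ n (Suc k) - 1) * scale (Suc k)"
    using scale_pos[of "Suc k"] by (intro mult_right_mono) auto
  also have "\<dots> = (scale k + 2 * tail k) - (scale (Suc k) + 2 * tail (Suc k))"
    using scale_eq_Suc[of k] tail_eq_Suc[of k] by (simp add: algebra_simps)
  finally show ?thesis
    by (simp add: d(2))
qed

lemma sum_blocks_le:
  assumes "k \<le> l"
  shows "sum (mm_seq n) (A \<inter> {mm_N n k<..mm_N n l}) \<le>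
    (scale k + 2 * tail k) - (scale l + 2 * tail l)"
  using assms
proof (induction l rule: dec_induct)
  case (step l)
  have "A \<inter> {mm_N n k<..mm_N n (Suc l)} =
      (A \<inter> {mm_N n k<..mm_N n l}) \<union> (A \<inter> {mm_N n l<..mm_N n (Suc l)})"
    using mm_N_mono[of k l n] mm_N_mono[of l "Suc l" n] step.hyps by auto
  then have "sum (mm_seq n) (A \<inter> {mm_N n k<..mm_N n (Suc l)}) =
      sum (mm_seq n) (A \<inter> {mm_N n k<..mm_N n l}) +
      sum (mm_seq n) (A \<inter> {mm_N n l<..mm_N n (Suc l)})"
    by (simp only:) (rule sum.union_disjoint; auto)
  with step.IH sum_block_le[of "A \<inter> {mm_N n l<..mm_N n (Suc l)}" l] show ?case
    by auto
qed simp

text \<open>The blocks after \<open>k\<close> contribute between 0 and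
  \<open>scale k + 2 * tail k\<close>, so each hull exceeds the full interval of its prefix sum by
  \<open>tail k\<close> on either side.\<close>

lemma cantorval_subset_prefix_hulls:
  assumes "x \<in> mm_cantorval n"
  shows "\<exists>g\<in>prefix_sums k.
    x \<in> {of_int g * scale k..of_int g * scale k + (scale k + 2 * tail k)}"
proof -
  obtain A where A: "A \<subseteq> {1..}" "(mm_seq n has_sum x) A"
    using assms by (auto simp: mm_cantorval_def achievement_set_def)
  let ?F = "A \<inter> {1..mm_N n k}"
  obtain g where g: "g \<in> prefix_sums k" "sum (mm_seq n) ?F = of_int g * scale k"
    using sum_in_prefix_sums[of ?F k] by auto
  have "sum (mm_seq n) ?F \<le> x"
    using A by (intro finite_sum_le_has_sum[OF A(2)] mm_seq_nonneg) auto
  moreover have "x \<le> sum (mm_seq n) ?F + (scale k + 2 * tail k)"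
  proof (rule tendsto_upperbound[OF A(2)[unfolded has_sum_def]])
    show "\<forall>\<^sub>F X in finite_subsets_at_top A.
        sum (mm_seq n) X \<le> sum (mm_seq n) ?F + (scale k + 2 * tail k)"
    proof (rule eventually_finite_subsets_at_top_weakI)
      fix X assume X: "finite X" "X \<subseteq> A"
      \<comment> \<open>The first \<open>l\<close> blocks contain \<open>X\<close>, because every
        index \<open>a\<close> satisfies \<open>a \<le> mm_N n a\<close>; inserting 0 keeps
        \<open>Max\<close> defined for empty \<open>X\<close>.\<close>
      define l where "l = max k (Max (insert 0 X))"
      let ?H = "A \<inter> {mm_N n k<..mm_N n l}"
      have "a \<le> mm_N n l" if "a \<in> X" for a
      proof -
        have "a \<le> l"
          using X that by (auto simp: l_def le_max_iff_disj)
        then show ?thesis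
          using mm_N_ge[of l n] by linarith
      qed
      then have "X \<subseteq> ?F \<union> ?H"
        using X A(1) by force
      then have "sum (mm_seq n) X \<le> sum (mm_seq n) (?F \<union> ?H)"
        by (intro sum_mono2 mm_seq_nonneg) auto
      also have "\<dots> = sum (mm_seq n) ?F + sum (mm_seq n) ?H"
        by (rule sum.union_disjoint) auto
      also have "\<dots> \<le> sum (mm_seq n) ?F + (scale k + 2 * tail k)"
        using sum_blocks_le[of k l A] scale_pos[of l] tail_nonneg[of l] by (simp add: l_def)
      finally show "sum (mm_seq n) X \<le> sum (mm_seq n) ?F + (scale k + 2 * tail k)" .
    qed
  qed (rule finite_subsets_at_top_neq_bot)
  ultimately show ?thesis
    using g by auto
qed

lemma finite_prefix_sums: "finite (prefix_sums k)"
proof (induction k)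
  case (Suc k)
  have "digits (n (Suc k)) \<subseteq> {0..5 * 2 ^ n (Suc k)}"
    using zero_le_power[of "2::int" "n (Suc k)"] by (auto simp: digits_def)
  then have "finite (digits (n (Suc k)))"
    using finite_subset by blast
  with Suc have "finite ((\<lambda>(g, d). 3 * 2 ^ n (Suc k) * g + d) ` (prefix_sums k \<times> digits (n (Suc k))))"
    by blast
  moreover have "prefix_sums (Suc k) =
      (\<lambda>(g, d). 3 * 2 ^ n (Suc k) * g + d) ` (prefix_sums k \<times> digits (n (Suc k)))"
    by auto
  ultimately show ?case
    by simp
qed simp

section \<open>Gaps and their refinement\<close>

definition gaps :: "nat \<Rightarrow> int set" where
  "gaps k = {f. f \<notin> prefix_sums k \<and> (f - 1 \<in> prefix_sums k \<or> f + 1 \<in> prefix_sums k)}"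

lemma finite_gaps: "finite (gaps k)"
proof (rule finite_subset)
  show "gaps k \<subseteq> (\<lambda>g. g + 1) ` prefix_sums k \<union> (\<lambda>g. g - 1) ` prefix_sums k"
  proof
    fix f assume "f \<in> gaps k"
    then consider "f - 1 \<in> prefix_sums k" | "f + 1 \<in> prefix_sums k"
      by (auto simp: gaps_def)
    then show "f \<in> (\<lambda>g. g + 1) ` prefix_sums k \<union> (\<lambda>g. g - 1) ` prefix_sums k"
      by cases (auto intro: image_eqI[where x = "f - 1"] image_eqI[where x = "f + 1"])
  qed
qed (simp add: finite_prefix_sums)

text \<open>A frontier point lies in some hull but not inside its full interval, hence in the
  overhang, which is shorter than a tile. If the tile there were full as well, the two adjacent full
  tiles would make the point interior.\<close>

lemma frontier_subset_gaps:
  "frontier (mm_cantorval n) \<subseteq>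
    (\<Union>f\<in>gaps k. {of_int f * scale k + tail k..of_int f * scale k + tail k + scale k})"
proof
  let ?q = "scale k" and ?r = "tail k" and ?E = "mm_cantorval n"
  let ?I = "\<lambda>f::int. {of_int f * ?q + ?r..of_int f * ?q + ?r + ?q}"
  fix x assume x: "x \<in> frontier ?E"
  have "?E \<subseteq> (\<Union>g\<in>prefix_sums k. {of_int g * ?q..of_int g * ?q + (?q + 2 * ?r)})"
    using cantorval_subset_prefix_hulls by blast
  \<comment> \<open>Finitely many closed intervals also contain the closure, and with it the
    frontier.\<close>
  then have "closure ?E \<subseteq> (\<Union>g\<in>prefix_sums k. {of_int g * ?q..of_int g * ?q + (?q + 2 * ?r)})"
    by (rule closure_minimal) (auto intro: closed_UN finite_prefix_sums)
  then obtain g where g: "g \<in> prefix_sums k" "of_int g * ?q \<le> x" "x \<le> of_int g * ?q + (?q + 2 * ?r)"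
    using x by (force simp: frontier_def)
  have not_interior: "\<not> (a < x \<and> x < b)" if "{a<..<b} \<subseteq> ?E" for a b
    using x interior_maximal[OF that] by (auto simp: frontier_def)
  have full: "?I f \<subseteq> ?E" if "f \<in> prefix_sums k" for f
    using prefix_interval_subset_cantorval[OF that] .
  have le: "?r < ?q" and pos: "0 < ?q"
    by (rule tail_less_scale, rule scale_pos)
  \<comment> \<open>Adjacent full tiles share an endpoint, which is therefore interior to their
    union.\<close>
  have two: "\<not> (of_int h * ?q + ?r < x \<and> x < of_int (h + 1) * ?q + ?r + ?q)"
    if "h \<in> prefix_sums k" "h + 1 \<in> prefix_sums k" for h
  proof (rule not_interior)
    have "?I h \<union> ?I (h + 1) \<subseteq> ?E"
      using full that by blast
    then show "{of_int h * ?q + ?r<..<of_int (h + 1) * ?q + ?r + ?q} \<subseteq> ?E"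
      by (rule order_trans[rotated]) (auto simp: algebra_simps)
  qed
  have "\<not> (of_int g * ?q + ?r < x \<and> x < of_int g * ?q + ?r + ?q)"
    by (rule not_interior) (use full[OF g(1)] in auto)
  then consider "x \<le> of_int g * ?q + ?r" | "of_int g * ?q + ?r + ?q \<le> x"
    by linarith
  then show "x \<in> (\<Union>f\<in>gaps k. ?I f)"
  proof cases
    case 1
    have "x \<in> ?I (g - 1)"
      using 1 g(2) le by (auto simp: algebra_simps)
    moreover have "g - 1 \<notin> prefix_sums k"
    proof
      assume *: "g - 1 \<in> prefix_sums k"
      \<comment> \<open>This fails because \<open>x\<close> is at least \<open>g * scale k\<close>,
        which exceeds the left end of tile \<open>g - 1\<close> by
        \<open>scale k - tail k\<close>.\<close>
      have "\<not> of_int (g - 1) * ?q + ?r < x"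
        using two[OF *] 1 g(1) pos by (auto simp: algebra_simps)
      with g(2) le show False
        by (auto simp: algebra_simps)
    qed
    ultimately show ?thesis
      using g(1) by (intro UN_I[of "g - 1"]) (auto simp: gaps_def)
  next
    case 2
    have "x \<in> ?I (g + 1)"
      using 2 g(3) le by (auto simp: algebra_simps)
    moreover have "g + 1 \<notin> prefix_sums k"
    proof
      assume *: "g + 1 \<in> prefix_sums k"
      have "\<not> x < of_int (g + 1) * ?q + ?r + ?q"
        using two[OF g(1) *] 2 pos by (auto simp: algebra_simps)
      with g(3) le show False
        by (auto simp: algebra_simps)
    qed
    ultimately show ?thesis
      using g(1) by (intro UN_I[of "g + 1"]) (auto simp: gaps_def)
  qed
qed

text \<open>The interval of \<open>f\<close> at level \<open>k\<close> splits into those of \<open>3 * 2 ^ m * f + 2 ^ m + j\<close> at level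
  \<open>Suc k\<close>, where \<open>m = n (Suc k)\<close> and \<open>0 \<le> j < 3 * 2 ^ m\<close>. A gap of level \<open>Suc k\<close> lies in a gap \<open>f\<close> of
  level \<open>k\<close>, because the intervals of the prefix sums are full; the prefix sums next to \<open>f\<close>
  contribute only the sparse digits at the two ends.\<close>

lemma gaps_Suc_subset:
  "gaps (Suc k) \<subseteq>
    (\<lambda>(f, j). 3 * 2 ^ n (Suc k) * f + 2 ^ n (Suc k) + j) ` (gaps k \<times> gap_digits (n (Suc k)))"
proof
  define p :: int where "p = 2 ^ n (Suc k)"
  have p: "2 \<le> p" "even p"
    using two_le_power_n[of k, where 'a = int] n_pos[of "Suc k"] by (auto simp: p_def)
  fix f' assume f': "f' \<in> gaps (Suc k)"
  define f where "f = (f' - p) div (3 * p)"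
  define j where "j = (f' - p) mod (3 * p)"
  have f'_eq: "f' = 3 * p * f + p + j"
    using div_mult_mod_eq[of "f' - p" "3 * p"] by (simp add: f_def j_def algebra_simps)
  have j: "0 \<le> j" "j < 3 * p"
    using p by (auto simp: j_def)
  have f: "f \<notin> prefix_sums k"
  proof
    assume "f \<in> prefix_sums k"
    moreover have "p + j \<in> digits (n (Suc k))"
      using j by (intro middle_digits) (auto simp: p_def)
    ultimately have "f' \<in> prefix_sums (Suc k)"
      using f'_eq by (auto simp: p_def add.assoc)
    with f' show False
      unfolding gaps_def by blast
  qed
  \<comment> \<open>The sign \<open>e\<close> records on which side of \<open>f'\<close> a prefix
    sum lies, so that both sides are treated together.\<close>
  obtain e :: int where e: "e = 1 \<or> e = -1" "f' + e \<in> prefix_sums (Suc k)"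
  proof (cases "f' + 1 \<in> prefix_sums (Suc k)")
    case False
    with f' have "f' + -1 \<in> prefix_sums (Suc k)"
      by (simp add: gaps_def del: prefix_sums.simps)
    then show ?thesis
      using that by blast
  qed (use that in blast)
  then obtain g d where gd: "f' + e = 3 * p * g + d" "g \<in> prefix_sums k" "d \<in> digits (n (Suc k))"
    by (auto simp: p_def)
  have d: "0 \<le> d" "d < 5 * p" "even d \<Longrightarrow> d < 4 * p" "odd d \<Longrightarrow> p \<le> d"
    using gd(3) p by (auto simp: digits_def p_def)
  have key: "3 * p * (g - f) = p + j + e - d"
    using gd(1) f'_eq by (simp add: algebra_simps)
  \<comment> \<open>The right-hand side of \<open>key\<close> lies between \<open>- 4 * p\<close>
    and \<open>4 * p\<close>, so the parents \<open>f\<close> and \<open>g\<close> differ by at most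
    one tile.\<close>
  have "3 * p * (g - f) < 3 * p * 2"
    unfolding key using j d p e by auto
  then have "g - f < 2"
    using p by (subst (asm) mult_less_cancel_left_pos) auto
  moreover have "3 * p * (-2) < 3 * p * (g - f)"
    unfolding key using j d p e by auto
  then have "-2 < g - f"
    using p by (subst (asm) mult_less_cancel_left_pos) auto
  moreover have "g \<noteq> f"
    using f gd(2) by blast
  ultimately have "g = f - 1 \<or> g = f + 1"
    by linarith
  then have "f \<in> gaps k \<and> (even j \<and> 0 \<le> j \<and> j \<le> p \<or> odd j \<and> 2 * p - 1 \<le> j \<and> j < 3 * p)"
  proof
    assume g: "g = f - 1"
    \<comment> \<open>Now \<open>d\<close> is at least \<open>4 * p - 1\<close>, where all digits
      are odd; hence \<open>j\<close> is even. The value \<open>j = p\<close> can occur with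
      \<open>e = -1\<close>.\<close>
    with key have deq: "d = 4 * p + j + e"
      by simp
    have "j \<noteq> 0" if "odd j"
      using that by auto
    then have "even j \<and> j \<le> p"
      using e(1) deq d j p by (cases "even d") auto
    with g gd(2) f j show ?thesis
      by (auto simp: gaps_def)
  next
    assume g: "g = f + 1"
    \<comment> \<open>Now \<open>d\<close> is at most \<open>p\<close>, where all digits are even;
      hence \<open>j\<close> is odd. The value \<open>j = 2 * p - 1\<close> can occur with
      \<open>e = 1\<close>.\<close>
    with key have deq: "d = j + e - 2 * p"
      by simp
    have "j \<noteq> 3 * p - 1" if "even j"
      using that p(2) by auto
    then have "odd j \<and> 2 * p - 1 \<le> j"
      using e(1) deq d j p by (cases "even d") auto
    with g gd(2) f j show ?thesis
      by (auto simp: gaps_def)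
  qed
  then show "f' \<in>
    (\<lambda>(f, j). 3 * 2 ^ n (Suc k) * f + 2 ^ n (Suc k) + j) ` (gaps k \<times> gap_digits (n (Suc k)))"
    using f'_eq unfolding p_def gap_digits_def by (intro image_eqI[of _ _ "(f, j)"]) auto
qed

section \<open>Counting gaps and the measure estimate\<close>

lemma card_gaps_Suc_le: "card (gaps (Suc k)) \<le> card (gaps k) * (2 ^ n (Suc k) + 2)"
proof -
  have "card (gaps (Suc k)) \<le> card (gaps k \<times> gap_digits (n (Suc k)))"
    by (rule surj_card_le[OF _ gaps_Suc_subset]) (simp add: finite_gaps finite_gap_digits)
  also have "\<dots> \<le> card (gaps k) * (2 ^ n (Suc k) + 2)"
    unfolding card_cartesian_product
    by (intro mult_left_mono card_gap_digits n_pos) simp_all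
  finally show ?thesis .
qed

lemma measure_gaps_le:
  "real (card (gaps k)) * scale k \<le> real (card (gaps 0)) * scale 0 * (2 / 3) ^ k"
proof (induction k)
  case (Suc k)
  have "real (card (gaps (Suc k))) \<le> real (card (gaps k)) * (2 ^ n (Suc k) + 2)"
    using of_nat_mono[OF card_gaps_Suc_le[of k], where 'a = real] by (simp add: algebra_simps)
  \<comment> \<open>Positivity of \<open>n (Suc k)\<close> gives
    \<open>2 \<le> 2 ^ n (Suc k)\<close>, which absorbs the two extra gaps; dividing by
    \<open>3 * 2 ^ n (Suc k)\<close> then yields the ratio 2/3.\<close>
  also have "\<dots> \<le> real (card (gaps k)) * (2 * 2 ^ n (Suc k))"
    using two_le_power_n[of k, where 'a = real] by (intro mult_left_mono) auto
  finally have "real (card (gaps (Suc k))) * scale (Suc k) \<le>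
      real (card (gaps k)) * (2 * 2 ^ n (Suc k)) * scale (Suc k)"
    using scale_pos[of "Suc k"] by (intro mult_right_mono) auto
  also have "\<dots> = 2 / 3 * (real (card (gaps k)) * scale k)"
    unfolding scale_eq_Suc[of k] by simp
  also have "\<dots> \<le> 2 / 3 * (real (card (gaps 0)) * scale 0 * (2 / 3) ^ k)"
    using Suc.IH by (rule mult_left_mono) simp
  finally show ?case
    by simp
qed simp

lemma emeasure_frontier_le:
  "emeasure lborel (frontier (mm_cantorval n)) \<le> ennreal (real (card (gaps k)) * scale k)"
proof -
  let ?I = "\<lambda>f::int. {of_int f * scale k + tail k..of_int f * scale k + tail k + scale k}"
  have "emeasure lborel (frontier (mm_cantorval n)) \<le> emeasure lborel (\<Union>f\<in>gaps k. ?I f)"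
    using frontier_subset_gaps finite_gaps
    by (intro emeasure_mono) (auto intro!: borel_closed closed_UN)
  also have "\<dots> \<le> (\<Sum>f\<in>gaps k. emeasure lborel (?I f))"
    using finite_gaps by (intro emeasure_subadditive_finite) auto
  also have "\<dots> = (\<Sum>f\<in>gaps k. ennreal (scale k))"
    using scale_pos[of k] by (intro sum.cong) auto
  also have "\<dots> = ennreal (real (card (gaps k)) * scale k)"
    using scale_pos[of k] by (simp add: ennreal_mult ennreal_of_nat_eq_real_of_nat)
  finally show ?thesis .
qed

lemma emeasure_frontier: "emeasure lborel (frontier (mm_cantorval n)) = 0"
proof -
  have "emeasure lborel (frontier (mm_cantorval n)) \<le> ennreal (real (card (gaps 0)) * scale 0 * (2 / 3) ^ k)"
    for k
    using emeasure_frontier_le[of k] measure_gaps_le[of k] ennreal_leI order_trans by blast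
  moreover have "(\<lambda>k. ennreal (real (card (gaps 0)) * scale 0 * (2 / 3) ^ k)) \<longlonglongrightarrow> ennreal 0"
    by (intro tendsto_ennrealI tendsto_mult_right_zero LIMSEQ_realpow_zero) auto
  ultimately have "emeasure lborel (frontier (mm_cantorval n)) \<le> ennreal 0"
    by (intro LIMSEQ_le_const) auto
  then show ?thesis
    by simp
qed

end

theorem theorem9:
  fixes n :: "nat \<Rightarrow> nat"
  assumes "\<forall>k\<ge>1. n k \<ge> 1"
  shows "frontier (mm_cantorval n) \<in> null_sets lebesgue"
proof -
  interpret mm_sequence n
    by unfold_locales (use assms in blast)
  have "frontier (mm_cantorval n) \<in> null_sets lborel"
    using emeasure_frontier by (intro null_setsI) (auto intro: borel_closed)
  then show ?thesis
    by (rule null_sets_completionI)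
qed

end
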